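(* Let $L>0$, $T>0$, $f\in\mathcal H$, and suppose that $$|f(x)|\le\frac L{2\pi}e^{-\frac{|x|^2}{4T}}\ln\left(1+\frac{4T}{|x|^2}\right),\quad x\in\mathbb R^2\setminus\{0\}.$$ Let $F=\mathscr Ff$ and $G=\Psi F$. Then $G$ can be extended to an entire function $G_e$ on $\mathbb C$ of order $\le1$ and type $\le T$. Moreover, $F$ can also be extended to an entire function $F_e$ on $\mathbb C^2$, the extension is given by $F_e(s)=G_e(s_1^2+s_2^2)$, $s=(s_1,s_2)\in\mathbb C^2$, and $F_e$ is of order $\le2$ and type $\le T$.
   Context: $\mathbb R_+=(0,+\infty)$; function spaces are complex; pointwise bounds on $L^2$ functions are understood a.e. $\mathscr F$ is the unitary Fourier transform on $L^2(\mathbb R^2)$, $(\mathscr Ff)(\sigma)=\frac1{2\pi}\iint f(x)e^{-i\langle x,\sigma\rangle}dx$. $\mathcal H=\{f\in L^2(\mathbb R^2): \exists g\in L^2(\mathbb R_+),\ f(x)=g(|x|^2)\text{ a.e.}\}$, and $\Psi:\mathcal H\to L^2(\mathbb R_+)$ maps $f$ to this $g$; $\mathscr F$ maps $\mathcal H$ onto $\mathcal H$. An entire function $E$ (on $\mathbb C$ or $\mathbb C^2$) is said to be of order $\le p$ and type $\le T$ if for every $\varepsilon>0$ there is $C_\varepsilon$ with $|E(z)|\le C_\varepsilon e^{(T+\varepsilon)|z|^p}$ for all $z$. "Extended" means that the entire function agrees a.e. with the given function on $\mathbb R_+$ (resp. $\mathbb R^2$). *)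

theory Defs
  imports "HOL-Complex_Analysis.Complex_Analysis"
begin

text \<open>Square-integrable functions are handled through representatives: an equality between
  elements of an L2 space is an a.e. equality between functions.\<close>

definition L2 :: "'a measure \<Rightarrow> ('a \<Rightarrow> complex) set" where
  "L2 M = {f. f \<in> borel_measurable M \<and> integrable M (\<lambda>x. (norm (f x))\<^sup>2)}"

definition Rplus :: "real measure" where
  "Rplus = restrict_space lborel {0<..}"

definition fourier_integral :: "(real^2 \<Rightarrow> complex) \<Rightarrow> real^2 \<Rightarrow> complex" where
  "fourier_integral f \<sigma> =
     1 / (2 * of_real pi) * (LINT x|lborel. f x * exp (- (\<i> * of_real (x \<bullet> \<sigma>))))"

text \<open>\<open>is_fourier_transform f F\<close>: the function \<open>F\<close> represents the unitary Fourier transform of the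
  class of \<open>f\<close>. The transform is the continuous extension to L2 of the Fourier integral on the
  intersection of L1 and L2. The distances are \<open>nn_integral\<close>s, so that a difference that is
  not square integrable is at distance infinity rather than 0.\<close>

definition is_fourier_transform :: "(real^2 \<Rightarrow> complex) \<Rightarrow> (real^2 \<Rightarrow> complex) \<Rightarrow> bool" where
  "is_fourier_transform f F \<longleftrightarrow> f \<in> L2 lborel \<and> F \<in> L2 lborel \<and>
     (\<exists>u :: nat \<Rightarrow> real^2 \<Rightarrow> complex.
        (\<forall>n. u n \<in> L2 lborel \<and> integrable lborel (u n)) \<and>
        (\<lambda>n. \<integral>\<^sup>+x. ennreal ((norm (u n x - f x))\<^sup>2) \<partial>lborel) \<longlonglongrightarrow> 0 \<and>
        (\<lambda>n. \<integral>\<^sup>+\<sigma>. ennreal ((norm (fourier_integral (u n) \<sigma> - F \<sigma>))\<^sup>2) \<partial>lborel) \<longlonglongrightarrow> 0)"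

text \<open>\<open>is_Psi f g\<close>: the function \<open>g\<close>, of which only the values on the positive half-line matter,
  represents the image of \<open>f\<close> under the map \<open>\<Psi>\<close>.\<close>

definition is_Psi :: "(real^2 \<Rightarrow> complex) \<Rightarrow> (real \<Rightarrow> complex) \<Rightarrow> bool" where
  "is_Psi f g \<longleftrightarrow> f \<in> L2 lborel \<and> g \<in> L2 Rplus \<and> (AE x in lborel. f x = g ((norm x)\<^sup>2))"

definition radial_L2 :: "(real^2 \<Rightarrow> complex) set" where
  "radial_L2 = {f. \<exists>g. is_Psi f g}"

text \<open>Complex differentiability on \<open>\<complex>\<^sup>n\<close>: the real Frechet derivative exists everywhere and is
  complex linear (additivity is part of \<open>has_derivative\<close>).\<close>

definition entire_vec :: "(complex^'n \<Rightarrow> complex) \<Rightarrow> bool" where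
  "entire_vec E \<longleftrightarrow>
     (\<forall>z. \<exists>D. (E has_derivative D) (at z) \<and> (\<forall>c v. D (c *s v) = c * D v))"

definition order_type_le :: "('a::real_normed_vector \<Rightarrow> complex) \<Rightarrow> real \<Rightarrow> real \<Rightarrow> bool" where
  "order_type_le E p T \<longleftrightarrow>
     (\<forall>\<epsilon>>0. \<exists>C. \<forall>z. norm (E z) \<le> C * exp ((T + \<epsilon>) * norm z powr p))"

definition complex_vec :: "real^'n \<Rightarrow> complex^'n" where
  "complex_vec x = (\<chi> i. of_real (x $ i))"

end

theory Submission
  imports Defs "HOL-Probability.Probability"
begin

text \<open>
  Write \<open>f(x) = g(|x|\<^sup>2)\<close>. The bound on \<open>f\<close> gives \<open>\<integral> |g(r)| r\<^sup>k dr \<le> C k! (4 T)\<^sup>k\<close>, so the power series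
  obtained by expanding the Bessel kernel in \<open>1/2 \<integral> g(r) J\<^sub>0(sqrt (r z)) dr\<close> is dominated termwise by
  that of \<open>C exp (T |z|)\<close>. That this series represents \<open>\<Psi> F\<close> is checked without polar
  coordinates or the Plancherel theorem: testing \<open>F\<close> against the Gaussians \<open>exp (- p |\<sigma>|\<^sup>2)\<close>,
  whose Fourier transforms are explicit, determines the Laplace transform of \<open>G\<close>. For \<open>p > T\<close> it
  agrees with that of the series, and Laplace transforms are injective.
\<close>

text \<open>A disc of squared radius r has area \<pi> r, so the squared norm carries planar Lebesgue
  measure to \<pi> times Lebesgue measure on the half-line. This replaces polar coordinates and
  turns Gaussian weights on the plane into exponential weights on the half-line. Gaussian tests suit
  a transform that is known only as an L2 limit of Fourier integrals: for integrable functions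
  Fubini moves the Gaussian to the other side, and since Gaussians are square integrable,
  Cauchy-Schwarz carries the identity to the limit. The transform replaces the exponent p by 1/(4p),
  so g is integrated against exp(-r/(4p)). Expanding this exponential sets moments of size k! (4T)^k
  against coefficients 1/((4p)^k k!), which is a geometric series of ratio T/p. The growth exp(Tt)
  of the series for G imposes the same threshold p > T on its Laplace transform. Injectivity
  therefore has to work with large p alone; the points T + 1 + n, n a natural number,
  suffice.\<close>

section \<open>The half-line measure and the distribution of the squared norm in the plane\<close>

lemma space_Rplus: "space Rplus = {0<..}"
  by (simp add: Rplus_def space_restrict_space)

lemma borel_measurable_Rplus:
  "h \<in> borel_measurable borel \<Longrightarrow> h \<in> borel_measurable Rplus"
  by (simp add: Rplus_def measurable_restrict_space1)

lemma AE_Rplus_iff: "(AE t in Rplus. P t) \<longleftrightarrow> (AE t in lborel. 0 < t \<longrightarrow> P t)"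
  unfolding Rplus_def by (subst AE_restrict_space_iff) auto

lemma emeasure_lborel_cball_0_2:
  fixes r :: real
  assumes "r \<ge> 0"
  shows "emeasure lborel (cball (0::real^2) r) = ennreal (pi * r\<^sup>2)"
  using emeasure_cball[OF assms, of "0::real^2"] unit_ball_vol_even[of 1] by simp

text \<open>Both measures give {..a} the area of the disc of squared radius max a 0. These
  half-lines are stable under intersection, generate the Borel sets and exhaust the line with finite
  measure, so the measures coincide.\<close>

lemma distr_norm_square:
  "distr lborel borel (\<lambda>x::real^2. (norm x)\<^sup>2) =
     density lborel (\<lambda>r. ennreal pi * indicator {0<..} r)" (is "?M = ?N")
proof (rule measure_eqI_generator_eq[where E = "range (\<lambda>a::real. {..a})" and A = "\<lambda>n. {..real n}" and \<Omega> = UNIV])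
  show "Int_stable (range (\<lambda>a::real. {..a}))"
    by (auto simp: Int_stable_def)
  show "sets ?M = sigma_sets UNIV (range (\<lambda>a::real. {..a}))"
    "sets ?N = sigma_sets UNIV (range (\<lambda>a::real. {..a}))"
    by (simp_all add: borel_eq_atMost)
  have M: "emeasure ?M {..a} = ennreal (pi * max a 0)" for a
  proof (cases "a \<ge> 0")
    case True
    have "(\<lambda>x::real^2. (norm x)\<^sup>2) -` {..a} = cball 0 (sqrt a)"
      using True by (auto simp: real_le_rsqrt dest: sqrt_ge_absD intro: sqrt_le_D)
         (metis norm_ge_zero real_sqrt_abs abs_of_nonneg real_sqrt_le_iff real_sqrt_pow2 power_mono)
    then show ?thesis
      using True by (simp add: emeasure_distr emeasure_lborel_cball_0_2)
  next
    case False
    then have "(\<lambda>x::real^2. (norm x)\<^sup>2) -` {..a} = {}"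
      by (auto simp: not_le) (smt (verit) zero_le_power2)
    then show ?thesis
      using False by (simp add: emeasure_distr)
  qed
  have N: "emeasure ?N {..a} = ennreal (pi * max a 0)" for a
  proof -
    have "emeasure ?N {..a} = (\<integral>\<^sup>+ r. ennreal pi * indicator {0<..max a 0} r \<partial>lborel)"
      by (subst emeasure_density) (auto intro!: nn_integral_cong split: split_indicator)
    then show ?thesis
      by (simp add: nn_integral_cmult_indicator ennreal_mult)
  qed
  show "\<And>X. X \<in> range (\<lambda>a::real. {..a}) \<Longrightarrow> emeasure ?M X = emeasure ?N X"
    using M N by auto
  show "(\<Union>i. {..real i}) = UNIV"
    by (auto intro: real_arch_simple)
  show "emeasure ?M {..real i} \<noteq> \<infinity>" for i
    by (simp add: M)
qed auto

text \<open>The image measure has a density that is positive exactly on the positive half-line, so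
  null sets transfer in both directions. The predicate has to be Borel on the whole line, which is
  why radial profiles are later replaced by Borel representatives.\<close>

lemma AE_norm_square_iff:
  assumes "Measurable.pred borel P"
  shows "(AE x::real^2 in lborel. P ((norm x)\<^sup>2)) \<longleftrightarrow> (AE r in Rplus. P r)"
proof -
  have "(AE x::real^2 in lborel. P ((norm x)\<^sup>2)) \<longleftrightarrow>
      (AE r in distr lborel borel (\<lambda>x::real^2. (norm x)\<^sup>2). P r)"
    by (subst AE_distr_iff) (use assms in auto)
  also have "\<dots> \<longleftrightarrow> (AE r in lborel. 0 < r \<longrightarrow> P r)"
    unfolding distr_norm_square
    by (subst AE_density) (auto simp: indicator_def)
  also have "\<dots> \<longleftrightarrow> (AE r in Rplus. P r)"
    by (simp only: AE_Rplus_iff)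
  finally show ?thesis .
qed

lemma integral_norm_square:
  fixes h :: "real \<Rightarrow> complex"
  assumes [measurable]: "h \<in> borel_measurable borel"
  shows "(LINT x::real^2|lborel. h ((norm x)\<^sup>2)) = of_real pi * (LINT r|Rplus. h r)"
proof -
  have "(LINT x::real^2|lborel. h ((norm x)\<^sup>2)) =
      (LINT r|density lborel (\<lambda>r. ennreal (pi * indicator {0<..} r)). h r)"
    using integral_distr[of "\<lambda>x::real^2. (norm x)\<^sup>2" lborel borel h]
    unfolding distr_norm_square
    by (simp add: ennreal_mult ennreal_indicator)
  also have "\<dots> = of_real pi * (LINT r|lborel. indicator {0<..} r *\<^sub>R h r)"
    by (subst integral_density) (simp_all add: scaleR_conv_of_real mult_ac flip: integral_mult_right_zero)
  finally show ?thesis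
    by (simp add: Rplus_def integral_restrict_space)
qed

lemma has_bochner_integral_Rplus_power_exp:
  assumes "p > 0"
  shows "has_bochner_integral Rplus (\<lambda>t. t ^ k * exp (- (p * t))) (fact k / p ^ Suc k)"
proof (rule has_bochner_integral_nn_integral)
  show "(\<lambda>t. t ^ k * exp (- (p * t))) \<in> borel_measurable Rplus"
    by (rule borel_measurable_Rplus) simp
  show "AE t in Rplus. 0 \<le> t ^ k * exp (- (p * t))"
    by (rule AE_I2) (simp add: space_Rplus)
  \<comment> \<open>For k = 0 the identity fails at t = 0: the indicator vanishes there, the Erlang
    density does not.\<close>
  have eq: "ennreal (t ^ k * exp (- (p * t))) * indicator {0<..} t =
      ennreal (fact k / p ^ Suc k) * ennreal (erlang_density k p t)" if "t \<noteq> 0" for t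
    using assms that by (auto simp: erlang_density_def ennreal_mult[symmetric] split: split_indicator)
  have "(\<integral>\<^sup>+t. ennreal (t ^ k * exp (- (p * t))) \<partial>Rplus) =
      (\<integral>\<^sup>+t. ennreal (t ^ k * exp (- (p * t))) * indicator {0<..} t \<partial>lborel)"
    unfolding Rplus_def by (subst nn_integral_restrict_space) auto
  also have "\<dots> = (\<integral>\<^sup>+t. ennreal (fact k / p ^ Suc k) * ennreal (erlang_density k p t) \<partial>lborel)"
    by (intro nn_integral_cong_AE eventually_mono[OF AE_lborel_singleton[of 0] eq])
  also have "\<dots> = ennreal (fact k / p ^ Suc k)"
    using nn_integral_erlang_ith_moment[OF assms, of k 0] by (simp add: nn_integral_cmult)
  finally show "(\<integral>\<^sup>+t. ennreal (t ^ k * exp (- (p * t))) \<partial>Rplus) = ennreal (fact k / p ^ Suc k)" .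
qed (use assms in auto)

section \<open>Injectivity of the Laplace transform\<close>

text \<open>Since \<open>ennreal\<close> truncates negative numbers to 0,
  \<open>ennreal (k t)\<close> and \<open>ennreal (- k t)\<close> are the positive and negative
  parts of k. As densities they define finite measures that agree on all open upper half-lines,
  hence are equal; so the two parts agree a.e., which forces both to vanish.\<close>

lemma AE_zero_if_integral_Ioi_zero:
  fixes k :: "real \<Rightarrow> real"
  assumes k: "integrable lborel k"
    and zero: "\<And>a. (LINT t|lborel. indicator {a<..} t * k t) = 0"
  shows "AE t in lborel. k t = 0"
proof -
  have [measurable]: "k \<in> borel_measurable borel"
    using borel_measurable_integrable[OF k] by simp
  have fin: "(\<integral>\<^sup>+t. ennreal (k t) \<partial>lborel) < \<infinity>" "(\<integral>\<^sup>+t. ennreal (- k t) \<partial>lborel) < \<infinity>"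
    using k by (auto simp: real_integrable_def less_top)
  have ind: "ennreal (indicator A t * x) = ennreal x * indicator A t" for A and t x :: real
    by (simp split: split_indicator)
  have eq: "(\<integral>\<^sup>+t. ennreal (k t) * indicator {a<..} t \<partial>lborel) =
      (\<integral>\<^sup>+t. ennreal (- k t) * indicator {a<..} t \<partial>lborel)" (is "?P = ?Q") for a
  proof -
    have int: "integrable lborel (\<lambda>t. indicator {a<..} t * k t)"
      using integrable_mult_indicator[OF _ k, of "{a<..}"] by simp
    have "enn2real ?P = enn2real ?Q"
      using zero[of a] real_lebesgue_integral_def[OF int]
        ind[of _ _ "- k _"] by (simp add: ind)
    moreover have "?P \<le> (\<integral>\<^sup>+t. ennreal (k t) \<partial>lborel)" "?Q \<le> (\<integral>\<^sup>+t. ennreal (- k t) \<partial>lborel)"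
      by (auto intro!: nn_integral_mono split: split_indicator)
    ultimately show ?thesis
      using fin by (metis ennreal_enn2real le_less_trans infinity_ennreal_def)
  qed
  have "density lborel (\<lambda>t. ennreal (k t)) = density lborel (\<lambda>t. ennreal (- k t))"
  proof (rule measure_eqI_lessThan)
    fix a
    have "(\<integral>\<^sup>+t. ennreal (k t) * indicator {a<..} t \<partial>lborel) \<le> (\<integral>\<^sup>+t. ennreal (k t) \<partial>lborel)"
      by (auto intro!: nn_integral_mono split: split_indicator)
    then show "emeasure (density lborel (\<lambda>t. ennreal (k t))) {a<..} < \<infinity>"
      using fin(1) by (simp add: emeasure_density)
    show "emeasure (density lborel (\<lambda>t. ennreal (k t))) {a<..} =
        emeasure (density lborel (\<lambda>t. ennreal (- k t))) {a<..}"
      by (simp add: emeasure_density eq)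
  qed auto
  then have "AE t in lborel. ennreal (k t) = ennreal (- k t)"
    using fin by (subst (asm) finite_density_unique) auto
  then show ?thesis
    by eventually_elim (metis ennreal_eq_0_iff ennreal_neg linorder_linear neg_le_0_iff_le order_antisym)
qed

lemma integral_Rplus_lborel:
  fixes h :: "real \<Rightarrow> 'a::{banach,second_countable_topology}"
  shows "(LINT t|Rplus. h t) = (LINT t|lborel. indicator {0<..} t *\<^sub>R h t)"
  by (simp add: Rplus_def integral_restrict_space)

lemma integrable_Rplus_iff:
  fixes h :: "real \<Rightarrow> 'a::{banach,second_countable_topology}"
  shows "integrable Rplus h \<longleftrightarrow> integrable lborel (\<lambda>t. indicator {0<..} t *\<^sub>R h t)"
  by (simp add: Rplus_def integrable_restrict_space)

lemma AE_Rplus_zero_if_integral_Ioi_zero: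
  fixes k :: "real \<Rightarrow> complex"
  assumes k: "integrable Rplus k"
    and zero: "\<And>a. (LINT t|Rplus. of_real (indicator {a<..} t) * k t) = 0"
  shows "AE t in Rplus. k t = 0"
proof -
  have part: "AE t in Rplus. q (k t) = 0" if q: "bounded_linear q" for q :: "complex \<Rightarrow> real"
  proof -
    interpret q: bounded_linear q by (rule q)
    have "(LINT t|lborel. indicator {a<..} t * (indicator {0<..} t * q (k t))) = 0" for a
    proof -
      have "integrable lborel (\<lambda>t. indicator {a<..} t *\<^sub>R (indicator {0<..} t *\<^sub>R k t))"
        by (rule integrable_mult_indicator[OF _ k[unfolded integrable_Rplus_iff]]) simp
      from integral_bounded_linear[OF q this]
      have "(LINT t|lborel. q (indicator {a<..} t *\<^sub>R (indicator {0<..} t *\<^sub>R k t))) =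
          q (LINT t|Rplus. of_real (indicator {a<..} t) * k t)"
        by (simp add: integral_Rplus_lborel scaleR_conv_of_real mult_ac)
      then show ?thesis
        by (simp add: zero q.scaleR mult.assoc)
    qed
    moreover have "integrable lborel (\<lambda>t. indicator {0<..} t * q (k t))"
      using integrable_bounded_linear[OF q k[unfolded integrable_Rplus_iff]] by (simp add: q.scaleR)
    ultimately have "AE t in lborel. indicator {0<..} t * q (k t) = 0"
      by (intro AE_zero_if_integral_Ioi_zero)
    then show ?thesis
      unfolding AE_Rplus_iff by eventually_elim (auto simp: indicator_def)
  qed
  from part[OF bounded_linear_Re] part[OF bounded_linear_Im] show ?thesis
    by eventually_elim (simp add: complex_eq_iff)
qed

text \<open>In the variable \<open>exp (- t)\<close> the hypothesis says that all moments vanish, so the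
  Weierstrass theorem applies.\<close>
lemma laplace_transform_unique:
  fixes k :: "real \<Rightarrow> complex"
  assumes k: "integrable Rplus k"
    and zero: "\<And>n::nat. (LINT t|Rplus. of_real (exp (- t) ^ n) * k t) = 0"
  shows "AE t in Rplus. k t = 0"
proof (rule AE_Rplus_zero_if_integral_Ioi_zero[OF k])
  fix a :: real
  have mk[measurable]: "k \<in> borel_measurable Rplus"
    using k by simp
  have bounded: "integrable Rplus (\<lambda>t. of_real (u t) * k t)"
    if "u \<in> borel_measurable borel" "\<And>t. t > 0 \<Longrightarrow> \<bar>u t\<bar> \<le> c" for u :: "real \<Rightarrow> real" and c
  proof (rule Bochner_Integration.integrable_bound)
    show "integrable Rplus (\<lambda>t. c *\<^sub>R k t)"
      using k by simp
    show "(\<lambda>t. of_real (u t) * k t) \<in> borel_measurable Rplus"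
      using borel_measurable_Rplus[OF that(1)] by simp
    show "AE t in Rplus. norm (of_real (u t) * k t) \<le> norm (c *\<^sub>R k t)"
      by (rule AE_I2) (use that(2) in \<open>force simp: space_Rplus norm_mult intro!: mult_right_mono\<close>)
  qed
  have poly: "(LINT t|Rplus. of_real (q (exp (- t))) * k t) = 0"
    if q: "real_polynomial_function q" for q
  proof -
    obtain c n where q: "q = (\<lambda>x. \<Sum>i\<le>n. c i * x ^ i)"
      using q by (auto simp: real_polynomial_function_iff_sum)
    have "(LINT t|Rplus. of_real (q (exp (- t))) * k t) =
        (LINT t|Rplus. (\<Sum>i\<le>n. of_real (c i) * (of_real (exp (- t) ^ i) * k t)))"
      by (rule Bochner_Integration.integral_cong) (simp_all add: q sum_distrib_right mult.assoc)
    also have "\<dots> = (\<Sum>i\<le>n. of_real (c i) * (LINT t|Rplus. of_real (exp (- t) ^ i) * k t))"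
    proof (subst Bochner_Integration.integral_sum)
      show "integrable Rplus (\<lambda>t. of_real (c i) * (of_real (exp (- t) ^ i) * k t))" for i
        by (intro integrable_mult_right bounded[of _ 1]) (auto simp: power_le_one)
    qed simp
    finally show ?thesis
      using zero by simp
  qed
  have cont: "(LINT t|Rplus. of_real (v (exp (- t))) * k t) = 0"
    if v: "continuous_on UNIV v" and vb: "\<And>x. \<bar>v x\<bar> \<le> 1" for v :: "real \<Rightarrow> real"
  proof -
    let ?N = "LINT t|Rplus. norm (k t)"
    have [measurable]: "v \<in> borel_measurable borel"
      using v by (rule borel_measurable_continuous_onI)
    \<comment> \<open>For t > 0 the point exp(-t) lies in [0,1], where v is uniformly within e of a
      polynomial. The polynomial integrates to 0 by the moment condition, so only the error
      survives.\<close>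
    have le: "norm (LINT t|Rplus. of_real (v (exp (- t))) * k t) \<le> e * ?N" if "e > 0" for e
    proof -
      obtain q where q: "real_polynomial_function q"
        and qv: "\<And>x. x \<in> {0..1} \<Longrightarrow> \<bar>v x - q x\<bar> < e"
        using Stone_Weierstrass_polynomial_function[OF _ continuous_on_subset[OF v], of "{0..1}" e]
          \<open>e > 0\<close> by (auto simp: real_polynomial_function_eq)
      have qm[measurable]: "q \<in> borel_measurable borel"
        by (rule borel_measurable_continuous_onI)
          (use q in \<open>auto simp: real_polynomial_function_eq intro: continuous_on_polymonial_function\<close>)
      have small: "\<bar>v (exp (- t)) - q (exp (- t))\<bar> \<le> e" if "t > 0" for t
        using qv[of "exp (- t)"] that by simp
      have i1: "integrable Rplus (\<lambda>t. of_real (v (exp (- t))) * k t)"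
        by (rule bounded[of _ 1]) (auto simp: vb)
      have i2: "integrable Rplus (\<lambda>t. of_real (v (exp (- t)) - q (exp (- t))) * k t)"
        by (rule bounded[of _ e]) (auto simp: small)
      have "(LINT t|Rplus. of_real (v (exp (- t))) * k t) =
          (LINT t|Rplus. of_real (v (exp (- t)) - q (exp (- t))) * k t)"
        using Bochner_Integration.integral_diff[OF i1 i2] poly[OF q] by (simp add: algebra_simps)
      also have "norm \<dots> \<le> (LINT t|Rplus. norm (of_real (v (exp (- t)) - q (exp (- t))) * k t))"
        by (rule integral_norm_bound)
      also have "\<dots> \<le> (LINT t|Rplus. e * norm (k t))"
        by (intro integral_mono_AE integrable_norm i2 integrable_mult_right k AE_I2)
          (auto simp: norm_mult space_Rplus small simp flip: of_real_diff intro!: mult_right_mono)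
      finally show ?thesis
        using k by simp
    qed
    \<comment> \<open>\<open>?N\<close> may be 0, so the tolerance is divided by
      \<open>?N + 1\<close>.\<close>
    have "?N + 1 > 0"
      by (intro add_nonneg_pos) auto
    have "norm (LINT t|Rplus. of_real (v (exp (- t))) * k t) \<le> 0 + e" if "e > 0" for e
    proof -
      have "?N / (?N + 1) \<le> 1"
        using \<open>?N + 1 > 0\<close> by (simp only: divide_le_eq_1_pos)
      from mult_left_mono[OF this, of e] have "e / (?N + 1) * ?N \<le> e"
        using that by simp
      moreover have "e / (?N + 1) > 0"
        using \<open>?N + 1 > 0\<close> that by (rule divide_pos_pos[rotated])
      ultimately show ?thesis
        using le by fastforce
    qed
    then show ?thesis
      using field_le_epsilon by (metis norm_le_zero_iff)
  qed
  \<comment> \<open>Continuous ramps in the variable x = exp(-t): they vanish for x \<ge> exp(-a)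
    and tend to 1 for x < exp(-a). The limit at t = a is thus 0, in agreement with the open
    half-line {a<..}.\<close>
  define v where "v n x = min 1 (max 0 (real n * (exp (- a) - x)))" for n x
  have v_bound: "\<bar>v n x\<bar> \<le> 1" for n x
    by (simp add: v_def)
  have v_lim: "(\<lambda>n. v n (exp (- t))) \<longlonglongrightarrow> indicator {a<..} t" for t
  proof (cases "t > a")
    case True
    then have pos: "exp (- a) - exp (- t) > 0" by simp
    then obtain N where N: "real N * (exp (- a) - exp (- t)) > 1"
      using reals_Archimedean3 by blast
    have "v n (exp (- t)) = 1" if "n \<ge> N" for n
    proof -
      have "real N * (exp (- a) - exp (- t)) \<le> real n * (exp (- a) - exp (- t))"
        using that pos by (intro mult_right_mono) auto
      then show ?thesis using N by (simp add: v_def)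
    qed
    then show ?thesis
      using True by (auto intro!: tendsto_eventually eventually_sequentiallyI)
  next
    case False
    then have "real n * (exp (- a) - exp (- t)) \<le> 0" for n
      by (intro mult_nonneg_nonpos) auto
    then have "v n (exp (- t)) = 0" for n
      by (simp add: v_def)
    then show ?thesis
      using False by simp
  qed
  have "(\<lambda>n. LINT t|Rplus. of_real (v n (exp (- t))) * k t) \<longlonglongrightarrow>
      (LINT t|Rplus. of_real (indicator {a<..} t) * k t)"
  proof (rule integral_dominated_convergence[where w = "\<lambda>t. norm (k t)"])
    show "AE t in Rplus. (\<lambda>n. of_real (v n (exp (- t))) * k t) \<longlonglongrightarrow> of_real (indicator {a<..} t) * k t"
      by (intro AE_I2 tendsto_mult tendsto_of_real v_lim tendsto_const)
    show "AE t in Rplus. norm (of_real (v n (exp (- t))) * k t) \<le> norm (k t)" for n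
      using v_bound[of n] by (intro AE_I2) (auto simp: norm_mult intro: mult_left_le_one_le)
    have "(\<lambda>t. v n (exp (- t))) \<in> borel_measurable borel" for n
      unfolding v_def by measurable
    from borel_measurable_Rplus[OF this]
    show "(\<lambda>t. of_real (v n (exp (- t))) * k t) \<in> borel_measurable Rplus" for n
      by measurable
    have "(\<lambda>t. indicator {a<..} t :: real) \<in> borel_measurable borel"
      by measurable
    from borel_measurable_Rplus[OF this]
    show "(\<lambda>t. of_real (indicator {a<..} t) * k t) \<in> borel_measurable Rplus"
      by measurable
  qed (use k in simp)
  moreover have "(LINT t|Rplus. of_real (v n (exp (- t))) * k t) = 0" for n
    by (rule cont) (auto simp: v_def[abs_def] intro!: continuous_intros)
  ultimately show "(LINT t|Rplus. of_real (indicator {a<..} t) * k t) = 0"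
    by (simp add: LIMSEQ_const_iff)
qed

section \<open>Power series of exponential type and their Laplace transforms\<close>

text \<open>Termwise comparison with C exp(T |z|) gives convergence and growth. The Laplace
  transform of t^n is n!/p^(n+1), so the norms of the transformed terms are at most (C/p) (T/p)^n;
  for p > T this is summable and justifies the exchange of sum and integral.\<close>

lemma power_series_of_exponential_type:
  fixes a :: "nat \<Rightarrow> complex"
  assumes a: "\<And>n. norm (a n) \<le> C * T ^ n / fact n" and T: "T > 0"
  defines "E \<equiv> \<lambda>z. \<Sum>n. a n * z ^ n"
  shows "E holomorphic_on UNIV"
    and "norm (E z) \<le> C * exp (T * norm z)"
    and "p > T \<Longrightarrow> integrable Rplus (\<lambda>t. of_real (exp (- (p * t))) * E (of_real t))"
    and "p > T \<Longrightarrow> (\<lambda>n. a n * (fact n / of_real p ^ Suc n)) sums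
           (LINT t|Rplus. of_real (exp (- (p * t))) * E (of_real t))"
proof -
  have bound: "norm (a n * z ^ n) \<le> C * ((T * norm z) ^ n / fact n)" for n z
    using mult_right_mono[OF a[of n], of "norm z ^ n"]
    by (simp add: norm_mult norm_power power_mult_distrib)
  have exp_sums: "(\<lambda>n. C * ((T * norm z) ^ n / fact n)) sums (C * exp (T * norm z))" for z :: complex
    using exp_converges[of "T * norm z"] by (intro sums_mult) (simp add: divide_inverse mult_ac)
  have norm_summable: "summable (\<lambda>n. norm (a n * z ^ n))" for z
    by (rule summable_comparison_test'[OF sums_summable[OF exp_sums[of z]]]) (use bound in simp)
  have E_sums: "(\<lambda>n. a n * z ^ n) sums E z" for z
    unfolding E_def by (rule summable_sums[OF summable_norm_cancel[OF norm_summable]])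
  show "E holomorphic_on UNIV"
  proof -
    have "E holomorphic_on ball 0 r" for r
      by (rule power_series_holomorphic[where a = a]) (use E_sums in simp)
    then have "E field_differentiable at z" for z
      by (rule holomorphic_on_imp_differentiable_at[of _ "ball 0 (norm z + 1)"]) auto
    then show ?thesis
      by (simp add: holomorphic_on_def)
  qed
  show "norm (E z) \<le> C * exp (T * norm z)"
  proof -
    have "norm (E z) \<le> (\<Sum>n. norm (a n * z ^ n))"
      unfolding E_def by (rule summable_norm[OF norm_summable])
    also have "\<dots> \<le> (\<Sum>n. C * ((T * norm z) ^ n / fact n))"
      by (rule suminf_le[OF bound norm_summable sums_summable[OF exp_sums]])
    also have "\<dots> = C * exp (T * norm z)"
      by (rule sums_unique[OF exp_sums, symmetric])
    finally show ?thesis .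
  qed
  assume p: "p > T"
  then have "p > 0" using T by simp
  let ?h = "\<lambda>n t. a n * of_real (t ^ n * exp (- (p * t)))"
  have h: "has_bochner_integral Rplus (?h n) (a n * (fact n / of_real p ^ Suc n))" for n
    using has_bochner_integral_of_real[OF has_bochner_integral_Rplus_power_exp[OF \<open>p > 0\<close>, of n],
        where 'a = complex]
    by (intro has_bochner_integral_mult_right) simp
  have norm_h: "(LINT t|Rplus. norm (?h n t)) = norm (a n) * (fact n / p ^ Suc n)" for n
  proof -
    have "(LINT t|Rplus. norm (?h n t)) = (LINT t|Rplus. norm (a n) * (t ^ n * exp (- (p * t))))"
      by (rule Bochner_Integration.integral_cong) (auto simp: norm_mult norm_power space_Rplus)
    then show ?thesis
      using has_bochner_integral_integral_eq[OF has_bochner_integral_Rplus_power_exp[OF \<open>p > 0\<close>, of n]]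
      by simp
  qed
  have sumE: "(\<Sum>n. ?h n t) = of_real (exp (- (p * t))) * E (of_real t)" for t
    using sums_unique[OF sums_mult[OF E_sums, of "of_real (exp (- (p * t)))" "of_real t"]]
    by (simp add: mult_ac)
  have int: "integrable Rplus (?h n)" for n
    using h by (rule integrable.intros)
  have ae: "AE t in Rplus. summable (\<lambda>n. norm (?h n t))"
  proof (rule AE_I2)
    fix t
    show "summable (\<lambda>n. norm (?h n t))"
      using summable_mult[OF norm_summable[of "of_real t"], of "exp (- (p * t))"]
      by (simp add: norm_mult norm_power mult_ac)
  qed
  have sm: "summable (\<lambda>n. LINT t|Rplus. norm (?h n t))"
  proof (rule summable_comparison_test')
    show "summable (\<lambda>n. C / p * (T / p) ^ n)"
      using p T by (intro summable_mult summable_geometric) simp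
    fix n
    have "norm (a n) * (fact n / p ^ Suc n) \<le> C * T ^ n / fact n * (fact n / p ^ Suc n)"
      using a[of n] \<open>p > 0\<close> by (intro mult_right_mono) auto
    also have "\<dots> = C / p * (T / p) ^ n"
      by (simp add: power_divide)
    finally show "norm (LINT t|Rplus. norm (?h n t)) \<le> C / p * (T / p) ^ n"
      unfolding norm_h using \<open>p > 0\<close> by simp
  qed
  show "integrable Rplus (\<lambda>t. of_real (exp (- (p * t))) * E (of_real t))"
    using integrable_suminf[OF int ae sm] unfolding sumE .
  show "(\<lambda>n. a n * (fact n / of_real p ^ Suc n)) sums
           (LINT t|Rplus. of_real (exp (- (p * t))) * E (of_real t))"
    using sums_integral[OF int ae sm] unfolding sumE has_bochner_integral_integral_eq[OF h] .
qed

section \<open>Fourier transforms of Gaussians\<close>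

text \<open>This is the characteristic function of the standard normal distribution after the
  substitution y \<mapsto> c y. The choice c = sqrt (2p) turns exp(-(c y)^2/2) into exp(-p y^2), and
  the frequency t = -x/c restores the phase -x y.\<close>

lemma fourier_gaussian_real:
  fixes p x :: real
  assumes p: "p > 0"
  shows "has_bochner_integral lborel
           (\<lambda>y. of_real (exp (- (p * y\<^sup>2))) * exp (- (\<i> * of_real (x * y))))
           (of_real (sqrt (pi / p) * exp (- (x\<^sup>2 / (4 * p)))))"
proof -
  define c where "c = sqrt (2 * p)"
  have c: "c > 0" "c\<^sup>2 = 2 * p"
    using p by (auto simp: c_def)
  define t where "t = - (x / c)"
  let ?h = "\<lambda>y. std_normal_density y *\<^sub>R iexp (t * y)"
  have int: "integrable lborel ?h"
  proof (rule Bochner_Integration.integrable_bound)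
    show "integrable lborel std_normal_density"
      using integrable_std_normal_moment[of 0] by simp
  qed (auto simp: normal_density_nonneg)
  have "(LINT y|lborel. ?h y) = char std_normal_distribution t"
    unfolding char_def by (subst integral_density) (auto simp: normal_density_nonneg)
  also have "\<dots> = of_real (exp (- (t\<^sup>2) / 2))"
    by (simp add: char_std_normal_distribution)
  also have "t\<^sup>2 = x\<^sup>2 / (2 * p)"
    by (simp add: t_def power_divide c)
  finally have val: "(LINT y|lborel. ?h (0 + c * y)) = of_real (exp (- (x\<^sup>2 / (4 * p))) / c)"
    using c lborel_integral_real_affine[of c ?h 0] by (simp add: field_simps scaleR_conv_of_real)
  have eq: "of_real (exp (- (p * y\<^sup>2))) * exp (- (\<i> * of_real (x * y))) =
      sqrt (2 * pi) *\<^sub>R ?h (0 + c * y)" for y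
    using c by (simp add: std_normal_density_def t_def power_mult_distrib scaleR_conv_of_real)
  have "integrable lborel (\<lambda>y. ?h (0 + c * y))"
    using int c by (intro lborel_integrable_real_affine) auto
  then have "has_bochner_integral lborel (\<lambda>y. sqrt (2 * pi) *\<^sub>R ?h (0 + c * y))
      (sqrt (2 * pi) *\<^sub>R of_real (exp (- (x\<^sup>2 / (4 * p))) / c))"
    unfolding val[symmetric] by (intro has_bochner_integral_scaleR_right) (rule has_bochner_integral_integrable)
  moreover have sqrt_2pi: "sqrt (2 * pi) = c * sqrt (pi / p)"
    using p by (simp add: c_def real_sqrt_mult real_sqrt_divide)
  have "sqrt (2 * pi) *\<^sub>R complex_of_real (exp (- (x\<^sup>2 / (4 * p))) / c) =
      of_real (sqrt (pi / p) * exp (- (x\<^sup>2 / (4 * p))))"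
    unfolding scaleR_conv_of_real of_real_mult[symmetric]
    using c by (simp add: sqrt_2pi)
  ultimately show ?thesis
    unfolding eq by (simp only:)
qed

text \<open>Lebesgue measure on a Euclidean space is the image of the product of one-dimensional
  Lebesgue measures indexed by \<open>Basis\<close>. Gaussians and plane waves both factor along
  \<open>Basis\<close>, which reduces their integrals to dimension one.\<close>

lemma has_bochner_integral_lborel_prod_Basis:
  fixes \<phi> :: "'a::euclidean_space \<Rightarrow> real \<Rightarrow> complex"
  assumes \<phi>: "\<And>b. b \<in> Basis \<Longrightarrow> has_bochner_integral lborel (\<phi> b) (I b)"
  shows "has_bochner_integral lborel (\<lambda>s. \<Prod>b\<in>Basis. \<phi> b (s \<bullet> b)) (\<Prod>b\<in>Basis. I b)"
proof -
  interpret product_sigma_finite "\<lambda>_::'a. lborel :: real measure" ..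
  have int: "integrable lborel (\<phi> b)" if "b \<in> Basis" for b
    using \<phi>[OF that] by (rule integrable.intros)
  then have [measurable]: "\<phi> b \<in> borel_measurable borel" if "b \<in> Basis" for b
    using that by (auto dest: borel_measurable_integrable)
  have eq: "(\<Prod>b\<in>Basis. \<phi> b ((\<Sum>i\<in>Basis. f i *\<^sub>R i) \<bullet> b)) = (\<Prod>b\<in>Basis. \<phi> b (f b))" for f
    by (rule prod.cong) simp_all
  have "integrable (Pi\<^sub>M Basis (\<lambda>_. lborel)) (\<lambda>f. \<Prod>b\<in>Basis. \<phi> b (f b))"
    by (rule product_integrable_prod) (use int in auto)
  moreover have "(\<integral>f. (\<Prod>b\<in>Basis. \<phi> b (f b)) \<partial>Pi\<^sub>M Basis (\<lambda>_. lborel)) = (\<Prod>b\<in>Basis. I b)"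
    by (subst product_integral_prod) (auto simp: int has_bochner_integral_integral_eq[OF \<phi>])
  ultimately show ?thesis
    unfolding has_bochner_integral_iff
    by (subst (1 2) lborel_eq) (simp add: integrable_distr_eq integral_distr eq)
qed

lemma fourier_gaussian:
  fixes x :: "'a::euclidean_space"
  assumes p: "p > 0"
  shows "has_bochner_integral lborel
           (\<lambda>\<sigma>. of_real (exp (- (p * (norm \<sigma>)\<^sup>2))) * exp (- (\<i> * of_real (x \<bullet> \<sigma>))))
           (of_real (sqrt (pi / p) ^ DIM('a) * exp (- ((norm x)\<^sup>2 / (4 * p)))))"
proof -
  have norm_sq: "(norm y)\<^sup>2 = (\<Sum>b\<in>Basis. (y \<bullet> b)\<^sup>2)" for y :: 'a
    unfolding power2_norm_eq_inner by (subst euclidean_inner) (simp add: power2_eq_square)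
  have gauss: "exp (- (q * (norm y)\<^sup>2)) = (\<Prod>b\<in>Basis. exp (- (q * (y \<bullet> b)\<^sup>2)))" for q and y :: 'a
    unfolding norm_sq sum_distrib_left sum_negf[symmetric] by (rule exp_sum) simp
  have "- (\<i> * complex_of_real (x \<bullet> \<sigma>)) = (\<Sum>b\<in>Basis. - (\<i> * of_real ((x \<bullet> b) * (\<sigma> \<bullet> b))))" for \<sigma>
    unfolding euclidean_inner[of x \<sigma>] of_real_sum sum_distrib_left sum_negf by (rule refl)
  then have wave: "exp (- (\<i> * complex_of_real (x \<bullet> \<sigma>))) =
      (\<Prod>b\<in>Basis. exp (- (\<i> * of_real ((x \<bullet> b) * (\<sigma> \<bullet> b)))))" for \<sigma>
    by (simp only: exp_sum finite_Basis)
  have val: "complex_of_real (sqrt (pi / p) ^ DIM('a) * exp (- ((norm x)\<^sup>2 / (4 * p)))) =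
      (\<Prod>b\<in>Basis. of_real (sqrt (pi / p) * exp (- ((x \<bullet> b)\<^sup>2 / (4 * p)))))"
    using gauss[of "1 / (4 * p)" x] by (simp add: prod.distrib)
  show ?thesis
    unfolding gauss wave val of_real_prod prod.distrib[symmetric]
    by (rule has_bochner_integral_lborel_prod_Basis[OF fourier_gaussian_real[OF p]])
qed

lemma gaussian_integrable:
  assumes "p > 0"
  shows "integrable lborel (\<lambda>\<sigma>::'a::euclidean_space. exp (- (p * (norm \<sigma>)\<^sup>2)))"
  using integrable_norm[OF integrable.intros[OF fourier_gaussian[OF assms, of 0]]]
  by simp

section \<open>Testing a Fourier transform against Gaussians\<close>

text \<open>Fubini applies because the kernel has absolute value |u(x)| exp(-p |\<sigma>|^2), a
  product of integrable functions. The constant 1/(2p) is the normalisation 1/(2\<pi>) times the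
  Gaussian mass \<pi>/p in dimension two.\<close>

lemma fourier_integral_gaussian_duality:
  fixes u :: "real^2 \<Rightarrow> complex"
  assumes u: "integrable lborel u" and p: "p > 0"
  shows "has_bochner_integral lborel (\<lambda>\<sigma>. fourier_integral u \<sigma> * of_real (exp (- (p * (norm \<sigma>)\<^sup>2))))
     (1 / (2 * of_real p) * (LINT x|lborel. u x * of_real (exp (- ((norm x)\<^sup>2 / (4 * p))))))"
proof -
  have [measurable]: "u \<in> borel_measurable borel"
    using borel_measurable_integrable[OF u] by simp
  let ?\<phi> = "\<lambda>\<sigma>::real^2. exp (- (p * (norm \<sigma>)\<^sup>2))"
  define K where "K x \<sigma> = u x * (of_real (?\<phi> \<sigma>) * exp (- (\<i> * of_real (x \<bullet> \<sigma>))))" for x \<sigma> :: "real^2"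
  have Km[measurable]: "case_prod K \<in> borel_measurable (lborel \<Otimes>\<^sub>M lborel)"
    unfolding K_def by measurable
  have norm_K: "norm (K x \<sigma>) = norm (u x) * ?\<phi> \<sigma>" for x \<sigma>
    by (simp add: K_def norm_mult)
  have K: "integrable (lborel \<Otimes>\<^sub>M lborel) (case_prod K)"
  proof (rule lborel_pair.Fubini_integrable[OF Km])
    show "integrable lborel (\<lambda>x. LINT \<sigma>|lborel. norm (case (x, \<sigma>) of (x, xa) \<Rightarrow> K x xa))"
      using u by (simp add: norm_K)
    show "AE x in lborel. integrable lborel (\<lambda>\<sigma>. case (x, \<sigma>) of (x, xa) \<Rightarrow> K x xa)"
      unfolding K_def prod.case
      by (intro AE_I2 integrable_mult_right integrable.intros[OF fourier_gaussian[OF p]])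
  qed
  have inner: "(LINT x|lborel. K x \<sigma>) = 2 * of_real pi * (fourier_integral u \<sigma> * of_real (?\<phi> \<sigma>))" for \<sigma>
  proof -
    have "(LINT x|lborel. K x \<sigma>) = (LINT x|lborel. u x * exp (- (\<i> * of_real (x \<bullet> \<sigma>))) * of_real (?\<phi> \<sigma>))"
      by (simp add: K_def mult_ac)
    then show ?thesis
      by (simp add: fourier_integral_def)
  qed
  have outer: "(LINT \<sigma>|lborel. K x \<sigma>) = of_real (pi / p) * (u x * of_real (exp (- ((norm x)\<^sup>2 / (4 * p)))))" for x
  proof -
    have "sqrt (pi / p) ^ DIM(real^2) = pi / p"
      using p by simp
    then show ?thesis
      unfolding K_def integral_mult_right_zero has_bochner_integral_integral_eq[OF fourier_gaussian[OF p]]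
      by (simp only: of_real_mult mult_ac)
  qed
  have "integrable lborel (\<lambda>\<sigma>. LINT x|lborel. K x \<sigma>)"
    by (rule lborel_pair.integrable_snd[OF K])
  moreover have "(LINT \<sigma>|lborel. LINT x|lborel. K x \<sigma>) = (LINT x|lborel. LINT \<sigma>|lborel. K x \<sigma>)"
    by (rule lborel_pair.Fubini_integral[OF K])
  ultimately have "has_bochner_integral lborel (\<lambda>\<sigma>. LINT x|lborel. K x \<sigma>)
      (of_real (pi / p) * (LINT x|lborel. u x * of_real (exp (- ((norm x)\<^sup>2 / (4 * p))))))"
    by (simp only: has_bochner_integral_iff outer integral_mult_right_zero simp_thms)
  from has_bochner_integral_mult_right[OF this, of "1 / (2 * of_real pi)"]
  show ?thesis
    unfolding inner using p by (simp add: mult.assoc[symmetric])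
qed

lemma L2_mult_integrable:
  fixes w :: "'a \<Rightarrow> real"
  assumes v: "v \<in> L2 M" and w: "w \<in> borel_measurable M" "integrable M (\<lambda>x. (w x)\<^sup>2)"
  shows "integrable M (\<lambda>x. v x * of_real (w x))"
proof (rule Bochner_Integration.integrable_bound)
  show "integrable M (\<lambda>x. (norm (v x))\<^sup>2 + (w x)\<^sup>2)"
    using v w by (auto simp: L2_def)
  show "(\<lambda>x. v x * of_real (w x)) \<in> borel_measurable M"
    using v w by (auto simp: L2_def)
  have "a * \<bar>b\<bar> \<le> a\<^sup>2 + b\<^sup>2" if "a \<ge> 0" for a b :: real
    using sum_squares_bound[of a "\<bar>b\<bar>"] mult_nonneg_nonneg[OF that abs_ge_zero[of b]] by simp
  then show "AE x in M. norm (v x * of_real (w x)) \<le> norm ((norm (v x))\<^sup>2 + (w x)\<^sup>2)"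
    by (intro AE_I2) (simp add: norm_mult)
qed

text \<open>Cauchy-Schwarz for nonnegative integrals: the squared difference of the integrals is at
  most the squared distance times the finite integral of w^2. Square integrability of
  \<open>v n\<close> is not assumed; for Fourier integrals, integrability against the weight comes
  from the Gaussian duality, without Plancherel.\<close>

lemma tendsto_integral_mult_L2:
  fixes v :: "nat \<Rightarrow> 'a \<Rightarrow> complex" and w :: "'a \<Rightarrow> real"
  assumes [measurable]: "\<And>n. v n \<in> borel_measurable M" "h \<in> borel_measurable M" "w \<in> borel_measurable M"
    and w: "integrable M (\<lambda>x. (w x)\<^sup>2)"
    and int: "\<And>n. integrable M (\<lambda>x. v n x * of_real (w x))" "integrable M (\<lambda>x. h x * of_real (w x))"
    and lim: "(\<lambda>n. \<integral>\<^sup>+x. ennreal ((norm (v n x - h x))\<^sup>2) \<partial>M) \<longlonglongrightarrow> 0"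
  shows "(\<lambda>n. LINT x|M. v n x * of_real (w x)) \<longlonglongrightarrow> (LINT x|M. h x * of_real (w x))"
proof -
  let ?d = "\<lambda>n. norm ((LINT x|M. v n x * of_real (w x)) - (LINT x|M. h x * of_real (w x)))"
  let ?b = "\<lambda>n. \<integral>\<^sup>+x. ennreal ((norm (v n x - h x))\<^sup>2) \<partial>M"
  let ?W = "\<integral>\<^sup>+x. ennreal ((w x)\<^sup>2) \<partial>M"
  have W: "?W \<noteq> \<infinity>"
    using w by (auto simp: integrable_iff_bounded)
  have le: "ennreal ((?d n)\<^sup>2) \<le> ?b n * ?W" for n
  proof -
    have i: "integrable M (\<lambda>x. v n x * of_real (w x) - h x * of_real (w x))"
      by (intro Bochner_Integration.integrable_diff int)
    have "ennreal (?d n) = ennreal (norm (LINT x|M. v n x * of_real (w x) - h x * of_real (w x)))"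
      by (simp only: Bochner_Integration.integral_diff[OF int])
    also have "\<dots> \<le> (\<integral>\<^sup>+x. norm (v n x * of_real (w x) - h x * of_real (w x)) \<partial>M)"
      by (rule integral_norm_bound_ennreal[OF i])
    also have "\<dots> = (\<integral>\<^sup>+x. ennreal (norm (v n x - h x)) * ennreal \<bar>w x\<bar> \<partial>M)"
      by (rule nn_integral_cong)
        (simp only: left_diff_distrib[symmetric] norm_mult norm_of_real ennreal_mult[OF norm_ge_zero abs_ge_zero])
    finally have "(ennreal (?d n))\<^sup>2 \<le> (\<integral>\<^sup>+x. ennreal (norm (v n x - h x)) * ennreal \<bar>w x\<bar> \<partial>M)\<^sup>2"
      by (rule power_mono) simp
    also have "\<dots> \<le> (\<integral>\<^sup>+x. (ennreal (norm (v n x - h x)))\<^sup>2 \<partial>M) * (\<integral>\<^sup>+x. (ennreal \<bar>w x\<bar>)\<^sup>2 \<partial>M)"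
      by (rule Cauchy_Schwarz_nn_integral) measurable
    finally show ?thesis
      by (simp only: ennreal_power norm_ge_zero abs_ge_zero power2_abs)
  qed
  have "(\<lambda>n. ?b n * ?W) \<longlonglongrightarrow> 0"
    using ennreal_tendsto_cmult[OF _ lim, of ?W] W by (simp add: mult.commute less_top)
  then have "(\<lambda>n. ennreal ((?d n)\<^sup>2)) \<longlonglongrightarrow> 0"
    by (rule tendsto_sandwich[OF _ _ tendsto_const, rotated -1]) (simp_all only: zero_le le eventually_sequentially simp_thms)
  then have "(\<lambda>n. (?d n)\<^sup>2) \<longlonglongrightarrow> 0"
    by (subst (asm) ennreal_tendsto_0_iff) simp_all
  from tendsto_real_sqrt[OF this] have "?d \<longlonglongrightarrow> 0"
    by (simp only: real_sqrt_zero real_sqrt_abs abs_norm_cancel)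
  then show ?thesis
    by (simp only: LIM_zero_iff tendsto_norm_zero_iff)
qed

text \<open>The identity holds for every approximant, and both of its sides converge, the Gaussian
  weights being square integrable.\<close>

lemma is_fourier_transform_gaussian_duality:
  assumes F: "is_fourier_transform f F" and p: "p > 0"
  shows "(LINT \<sigma>|lborel. F \<sigma> * of_real (exp (- (p * (norm \<sigma>)\<^sup>2)))) =
     1 / (2 * of_real p) * (LINT x|lborel. f x * of_real (exp (- ((norm x)\<^sup>2 / (4 * p)))))"
proof -
  obtain u where fF: "f \<in> L2 lborel" "F \<in> L2 lborel"
    and u: "\<And>n. u n \<in> L2 lborel" "\<And>n. integrable lborel (u n)"
    and uf: "(\<lambda>n. \<integral>\<^sup>+x. ennreal ((norm (u n x - f x))\<^sup>2) \<partial>lborel) \<longlonglongrightarrow> 0"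
    and uF: "(\<lambda>n. \<integral>\<^sup>+\<sigma>. ennreal ((norm (fourier_integral (u n) \<sigma> - F \<sigma>))\<^sup>2) \<partial>lborel) \<longlonglongrightarrow> 0"
    using F unfolding is_fourier_transform_def by blast
  have gm: "(\<lambda>x::real^2. exp (- (q * (norm x)\<^sup>2))) \<in> borel_measurable lborel" for q :: real
    by measurable
  have g2: "integrable lborel (\<lambda>x::real^2. (exp (- (q * (norm x)\<^sup>2)))\<^sup>2)" if "q > 0" for q
    using gaussian_integrable[of "2 * q", where 'a = "real^2"] that
    by (simp add: mult_ac flip: exp_double)
  have [measurable]: "u n \<in> borel_measurable borel" for n
    using u(1)[of n] by (simp add: L2_def)
  have ft: "fourier_integral (u n) \<in> borel_measurable lborel" for n
    unfolding fourier_integral_def by measurable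
  define q where "q = 1 / (4 * p)"
  have q: "q > 0" using p by (simp add: q_def)
  have dual: "has_bochner_integral lborel (\<lambda>\<sigma>. fourier_integral (u n) \<sigma> * of_real (exp (- (p * (norm \<sigma>)\<^sup>2))))
     (1 / (2 * of_real p) * (LINT x|lborel. u n x * of_real (exp (- (q * (norm x)\<^sup>2)))))" for n
    using fourier_integral_gaussian_duality[OF u(2)[of n] p] by (simp add: q_def)
  have "(\<lambda>n. LINT x|lborel. u n x * of_real (exp (- (q * (norm x)\<^sup>2)))) \<longlonglongrightarrow>
      (LINT x|lborel. f x * of_real (exp (- (q * (norm x)\<^sup>2))))"
    using u(1) fF(1)
    by (intro tendsto_integral_mult_L2 L2_mult_integrable gm g2[OF q] uf) (auto simp: L2_def)
  then have "(\<lambda>n. 1 / (2 * of_real p) * (LINT x|lborel. u n x * of_real (exp (- (q * (norm x)\<^sup>2))))) \<longlonglongrightarrow>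
      1 / (2 * of_real p) * (LINT x|lborel. f x * of_real (exp (- (q * (norm x)\<^sup>2))))"
    by (intro tendsto_mult tendsto_const)
  moreover have "(\<lambda>n. LINT \<sigma>|lborel. fourier_integral (u n) \<sigma> * of_real (exp (- (p * (norm \<sigma>)\<^sup>2)))) \<longlonglongrightarrow>
      (LINT \<sigma>|lborel. F \<sigma> * of_real (exp (- (p * (norm \<sigma>)\<^sup>2))))"
    using fF(2) by (intro tendsto_integral_mult_L2[OF ft _ gm g2[OF p] integrable.intros[OF dual] _ uF]
        L2_mult_integrable gm g2[OF p]) (auto simp: L2_def)
  then have "(\<lambda>n. 1 / (2 * of_real p) * (LINT x|lborel. u n x * of_real (exp (- (q * (norm x)\<^sup>2))))) \<longlonglongrightarrow>
      (LINT \<sigma>|lborel. F \<sigma> * of_real (exp (- (p * (norm \<sigma>)\<^sup>2))))"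
    by (simp only: has_bochner_integral_integral_eq[OF dual])
  ultimately have "(LINT \<sigma>|lborel. F \<sigma> * of_real (exp (- (p * (norm \<sigma>)\<^sup>2)))) =
      1 / (2 * of_real p) * (LINT x|lborel. f x * of_real (exp (- (q * (norm x)\<^sup>2))))"
    by (rule LIMSEQ_unique[rotated])
  then show ?thesis
    by (simp add: q_def)
qed

section \<open>Moments of the radial profile and the Taylor coefficients\<close>

text \<open>The inequality ln (1 + x) \<le> x trades the logarithm for 4T/r. This costs one power of
  r, so the pointwise bound yields every moment except the zeroth, for which square integrability of
  g is used.\<close>

lemma moment_bound:
  fixes g :: "real \<Rightarrow> complex"
  assumes g: "g \<in> L2 Rplus" and "B \<ge> 0" and "T > 0"
    and bound: "AE r in Rplus. norm (g r) \<le> B * exp (- (r / (4 * T))) * ln (1 + 4 * T / r)"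
  obtains C where "\<And>k. integrable Rplus (\<lambda>r. norm (g r) * r ^ k)"
    and "\<And>k. (LINT r|Rplus. norm (g r) * r ^ k) \<le> C * (fact k * (4 * T) ^ k)"
proof
  have gm[measurable]: "g \<in> borel_measurable Rplus"
    using g by (simp add: L2_def)
  have pm[measurable]: "(\<lambda>r. r ^ k) \<in> borel_measurable Rplus" for k :: nat
    by (rule borel_measurable_Rplus) simp
  define q where "q = 1 / (4 * T)"
  have q: "q > 0" "4 * T * q = 1"
    using \<open>T > 0\<close> by (simp_all add: q_def)
  note hbi = has_bochner_integral_Rplus_power_exp[OF q(1)]
  have Suc_le: "AE r in Rplus. norm (g r) * r ^ Suc k \<le> (4 * B * T) * (r ^ k * exp (- (q * r)))" for k
    using bound AE_space
  proof eventually_elim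
    case (elim r)
    then have r: "r > 0" by (simp add: space_Rplus)
    have "ln (1 + 4 * T / r) \<le> 4 * T / r"
      using r \<open>T > 0\<close> by (intro ln_add_one_self_le_self) simp
    then have "B * exp (- (r / (4 * T))) * ln (1 + 4 * T / r) \<le> B * exp (- (r / (4 * T))) * (4 * T / r)"
      using \<open>B \<ge> 0\<close> by (intro mult_left_mono) auto
    with elim(1) have "norm (g r) \<le> B * exp (- (r / (4 * T))) * (4 * T / r)"
      by linarith
    then have "norm (g r) * r ^ Suc k \<le> B * exp (- (r / (4 * T))) * (4 * T / r) * r ^ Suc k"
      using r by (intro mult_right_mono) auto
    also have "\<dots> = (4 * B * T) * (r ^ k * exp (- (q * r)))"
      using r by (simp add: q_def)
    finally show ?case .
  qed
  have int_Suc: "integrable Rplus (\<lambda>r. norm (g r) * r ^ Suc k)" for k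
  proof (rule Bochner_Integration.integrable_bound)
    show "integrable Rplus (\<lambda>r. (4 * B * T) * (r ^ k * exp (- (q * r))))"
      by (intro integrable_mult_right integrable.intros[OF hbi])
    show "(\<lambda>r. norm (g r) * r ^ Suc k) \<in> borel_measurable Rplus"
      by measurable
    show "AE r in Rplus. norm (norm (g r) * r ^ Suc k) \<le> norm (4 * B * T * (r ^ k * exp (- (q * r))))"
      using Suc_le[of k] AE_space
    proof eventually_elim
      case (elim r)
      then have "0 \<le> norm (g r) * r ^ Suc k" by (simp add: space_Rplus)
      with elim(1) show ?case by simp
    qed
  qed
  \<comment> \<open>Near 0 the estimate |g| \<le> |g|^2 + 1 avoids integrating the logarithm; beyond
    1, |g| is at most the integrand of the first moment.\<close>
  have int_0: "integrable Rplus (\<lambda>r. norm (g r))"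
  proof (rule Bochner_Integration.integrable_bound)
    show "integrable Rplus (\<lambda>r. ((norm (g r))\<^sup>2 + indicator {0<..1} r) + norm (g r) * r ^ Suc 0)"
    proof (intro Bochner_Integration.integrable_add int_Suc)
      show "integrable Rplus (\<lambda>r. (norm (g r))\<^sup>2)"
        using g by (simp add: L2_def)
      have "integrable lborel (\<lambda>t::real. indicator {0<..} t *\<^sub>R (indicator {0<..1} t :: real))"
        by (intro integrable_mult_indicator) (auto intro!: integrable_real_indicator)
      then show "integrable Rplus (indicator {0<..1} :: real \<Rightarrow> real)"
        by (simp only: integrable_Rplus_iff)
    qed
    show "AE r in Rplus. norm (norm (g r)) \<le>
        norm (((norm (g r))\<^sup>2 + indicator {0<..1} r) + norm (g r) * r ^ Suc 0)"
    proof (rule AE_I2)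
      fix r assume "r \<in> space Rplus"
      then have r: "r > 0" by (simp add: space_Rplus)
      have sq: "norm (g r) \<le> (norm (g r))\<^sup>2 + 1"
        using sum_squares_bound[of "norm (g r)" 1] norm_ge_zero[of "g r"]
        unfolding power_one mult_1_right by linarith
      have "norm (g r) \<le> ((norm (g r))\<^sup>2 + indicator {0<..1} r) + norm (g r) * r ^ Suc 0"
      proof (cases "r \<le> 1")
        case True
        with sq r show ?thesis by (simp add: indicator_def add_increasing2)
      next
        case False
        then have "norm (g r) * 1 \<le> norm (g r) * r"
          by (intro mult_left_mono) auto
        then show ?thesis by (simp add: indicator_def add_increasing)
      qed
      then show "norm (norm (g r)) \<le>
        norm (((norm (g r))\<^sup>2 + indicator {0<..1} r) + norm (g r) * r ^ Suc 0)"
        unfolding real_norm_def abs_norm_cancel by (rule order_trans[OF _ abs_ge_self])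
    qed
  qed measurable
  \<comment> \<open>The second entry of the maximum serves k = 0. For k = j + 1 the integral is at
    most 4BT j! (4T)^k, and j! is enlarged to k!.\<close>
  define C where "C = max (4 * B * T) (LINT r|Rplus. norm (g r))"
  show "integrable Rplus (\<lambda>r. norm (g r) * r ^ k)" for k
    using int_0 int_Suc by (cases k) simp_all
  show "(LINT r|Rplus. norm (g r) * r ^ k) \<le> C * (fact k * (4 * T) ^ k)" for k
  proof (cases k)
    case 0
    then show ?thesis by (simp add: C_def)
  next
    case (Suc j)
    have "(LINT r|Rplus. norm (g r) * r ^ k) \<le> (LINT r|Rplus. (4 * B * T) * (r ^ j * exp (- (q * r))))"
      unfolding Suc
      by (intro integral_mono_AE int_Suc Suc_le integrable_mult_right integrable.intros[OF hbi])
    also have "\<dots> = (4 * B * T) * (fact j / q ^ Suc j)"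
      by (simp only: integral_mult_right_zero has_bochner_integral_integral_eq[OF hbi])
    also have "fact j / q ^ Suc j = fact j * (4 * T) ^ k"
      by (simp add: q_def power_divide Suc del: power_Suc)
    also have "(4 * B * T) * (fact j * (4 * T) ^ k) \<le> C * (fact k * (4 * T) ^ k)"
    proof (rule mult_mono)
      show "4 * B * T \<le> C"
        by (simp add: C_def)
      have "0 \<le> 4 * B * T"
        using \<open>T > 0\<close> \<open>B \<ge> 0\<close> by simp
      then show "0 \<le> C"
        by (simp add: C_def le_max_iff_disj)
      have "(fact j :: real) \<le> fact k"
        unfolding Suc by (rule fact_mono) simp
      then show "fact j * (4 * T) ^ k \<le> fact k * (4 * T) ^ k"
        using \<open>T > 0\<close> by (intro mult_right_mono) auto
    qed (use \<open>T > 0\<close> in simp)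
    finally show ?thesis .
  qed
qed

text \<open>The Taylor coefficients of \<open>1/2 \<integral> g(r) J\<^sub>0(sqrt (r z)) dr\<close>.\<close>
definition hankel_coeff :: "(real \<Rightarrow> complex) \<Rightarrow> nat \<Rightarrow> complex" where
  "hankel_coeff g k = (- 1) ^ k * (LINT r|Rplus. g r * of_real (r ^ k)) / (2 * 4 ^ k * (fact k)\<^sup>2)"

text \<open>Dividing the moment bound by 4^k (k!)^2 leaves T^k/k!. The Laplace factor k!/p^(k+1)
  cancels one of the two factorials of the Bessel series, so an exponential series remains and sums
  under the integral to exp(-r/(4p)).\<close>

lemma hankel_coeff_bound_and_laplace:
  fixes g :: "real \<Rightarrow> complex"
  assumes gm[measurable]: "g \<in> borel_measurable Rplus" and T: "T > 0"
    and int: "\<And>k. integrable Rplus (\<lambda>r. norm (g r) * r ^ k)"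
    and le: "\<And>k. (LINT r|Rplus. norm (g r) * r ^ k) \<le> C * (fact k * (4 * T) ^ k)"
  shows "norm (hankel_coeff g k) \<le> C / 2 * T ^ k / fact k"
    and "p > T \<Longrightarrow> (\<lambda>k. hankel_coeff g k * (fact k / of_real p ^ Suc k)) sums
           (1 / (2 * of_real p) * (LINT r|Rplus. g r * of_real (exp (- (r / (4 * p))))))"
proof -
  have pm[measurable]: "(\<lambda>r. r ^ k) \<in> borel_measurable Rplus" for k :: nat
    by (rule borel_measurable_Rplus) simp
  have norm_eq: "(LINT r|Rplus. norm (g r * of_real (r ^ k))) = (LINT r|Rplus. norm (g r) * r ^ k)" for k
    by (rule Bochner_Integration.integral_cong) (auto simp: norm_mult norm_power space_Rplus)
  have int': "integrable Rplus (\<lambda>r. g r * of_real (r ^ k))" for k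
  proof (rule Bochner_Integration.integrable_bound[OF int[of k]])
    show "(\<lambda>r. g r * of_real (r ^ k)) \<in> borel_measurable Rplus"
      by (rule borel_measurable_times[OF gm borel_measurable_Rplus[OF borel_measurable_continuous_onI]])
        (intro continuous_intros)
    show "AE r in Rplus. norm (g r * of_real (r ^ k)) \<le> norm (norm (g r) * r ^ k)"
      by (rule AE_I2) (simp only: norm_mult norm_of_real real_norm_def abs_mult abs_norm_cancel order_refl)
  qed
  have m: "norm (LINT r|Rplus. g r * of_real (r ^ k)) \<le> C * (fact k * (4 * T) ^ k)" for k
    using order_trans[OF integral_norm_bound le[of k, folded norm_eq]] .
  have "norm (hankel_coeff g k) \<le> C * (fact k * (4 * T) ^ k) / (2 * 4 ^ k * (fact k)\<^sup>2)"
    using divide_right_mono[OF m[of k], of "2 * 4 ^ k * (fact k)\<^sup>2"]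
    by (simp add: hankel_coeff_def norm_mult norm_divide norm_power)
  also have "\<dots> = C / 2 * T ^ k / fact k"
    by (simp add: power_mult_distrib power2_eq_square)
  finally show "norm (hankel_coeff g k) \<le> C / 2 * T ^ k / fact k" .
  assume p: "p > T"
  then have "p > 0" using T by simp
  \<comment> \<open>Taylor coefficients of r \<mapsto> exp(-r/(4p)).\<close>
  define c where "c k = (- 1) ^ k / ((4 * p) ^ k * fact k)" for k
  let ?h = "\<lambda>k r. of_real (c k) * (g r * of_real (r ^ k))"
  have c_sums: "(\<lambda>k. c k * r ^ k) sums exp (- (r / (4 * p)))" for r
  proof -
    have "c k * r ^ k = (- (r / (4 * p))) ^ k /\<^sub>R fact k" for k
      unfolding c_def power_minus[of "r / (4 * p)"] power_divide[of r] real_scaleR_def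
      unfolding divide_inverse inverse_mult_distrib by (simp only: mult_ac)
    with exp_converges[of "- (r / (4 * p))"] show ?thesis
      by (simp only:)
  qed
  have c_abs: "\<bar>c k\<bar> = 1 / ((4 * p) ^ k * fact k)" for k
    using \<open>p > 0\<close> by (simp add: c_def abs_divide power_abs)
  have i: "integrable Rplus (?h k)" for k
    by (intro integrable_mult_right int')
  have sum_h: "(\<lambda>k. ?h k r) sums (g r * of_real (exp (- (r / (4 * p)))))" for r
    using sums_mult[OF sums_of_real[OF c_sums[of r], where 'a = complex], of "g r"]
    by (simp add: mult_ac)
  have ae: "AE r in Rplus. summable (\<lambda>k. norm (?h k r))"
  proof (rule AE_I2)
    fix r :: real assume "r \<in> space Rplus"
    then have "r > 0" by (simp add: space_Rplus)
    have "\<bar>c k\<bar> * r ^ k = (r / (4 * p)) ^ k /\<^sub>R fact k" for k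
      unfolding c_abs power_divide real_scaleR_def
      unfolding divide_inverse inverse_mult_distrib by (simp only: mult_ac mult_1_left)
    then have "summable (\<lambda>k. \<bar>c k\<bar> * r ^ k)"
      using summable_exp_generic[of "r / (4 * p)"] by simp
    from summable_mult[OF this, of "norm (g r)"] show "summable (\<lambda>k. norm (?h k r))"
      using \<open>r > 0\<close> by (simp add: norm_mult norm_power mult_ac)
  qed
  have sm: "summable (\<lambda>k. LINT r|Rplus. norm (?h k r))"
  proof (rule summable_comparison_test')
    show "summable (\<lambda>k. C * (T / p) ^ k)"
      using p T by (intro summable_mult summable_geometric) simp
    fix k
    have "(LINT r|Rplus. norm (?h k r)) = \<bar>c k\<bar> * (LINT r|Rplus. norm (g r) * r ^ k)"
      by (simp only: norm_mult[of "of_real _"] norm_of_real integral_mult_right_zero norm_eq)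
    also have "\<dots> \<le> \<bar>c k\<bar> * (C * (fact k * (4 * T) ^ k))"
      by (intro mult_left_mono le) simp
    also have "\<dots> = C * (T / p) ^ k"
    proof -
      have cancel: "1 / (X * F) * (C * (F * (X * Y))) = C * Y" if "X \<noteq> 0" "F \<noteq> 0" for X Y F :: real
        using that by simp
      have "4 * T = 4 * p * (T / p)"
        using \<open>p > 0\<close> by simp
      then have "(4 * T) ^ k = (4 * p) ^ k * (T / p) ^ k"
        by (simp only: power_mult_distrib)
      then show ?thesis
        unfolding c_abs using \<open>p > 0\<close> by (simp only:) (rule cancel, simp_all)
    qed
    finally show "norm (LINT r|Rplus. norm (?h k r)) \<le> C * (T / p) ^ k"
      by simp
  qed
  have S: "(\<lambda>k. LINT r|Rplus. ?h k r) sums (LINT r|Rplus. g r * of_real (exp (- (r / (4 * p)))))"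
    using sums_integral[OF i ae sm] unfolding sums_unique[OF sum_h, symmetric] .
  have eq: "1 / (2 * of_real p) * (LINT r|Rplus. ?h k r) =
      hankel_coeff g k * (fact k / of_real p ^ Suc k)" for k
  proof -
    have alg: "1 / (2 * P) * (e / (W * Q * F)) * z = e * z / (2 * W * F\<^sup>2) * (F / (P * Q))"
      if "P \<noteq> 0" "Q \<noteq> 0" "F \<noteq> 0" "W \<noteq> 0" for P Q F W e z :: complex
      using that by (simp add: power2_eq_square)
    have "complex_of_real (c k) = (- 1) ^ k / (4 ^ k * of_real p ^ k * fact k)"
      by (simp add: c_def power_mult_distrib)
    then have "1 / (2 * of_real p) * of_real (c k) * z =
        (- 1) ^ k * z / (2 * 4 ^ k * (fact k)\<^sup>2) * (fact k / of_real p ^ Suc k)" for z :: complex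
      using \<open>p > 0\<close> alg[of "of_real p" "of_real p ^ k" "fact k" "4 ^ k" "(- 1) ^ k" z]
      by (simp only: power_Suc of_real_eq_0_iff power_eq_0_iff fact_nonzero) simp
    moreover have "(LINT r|Rplus. ?h k r) = of_real (c k) * (LINT r|Rplus. g r * of_real (r ^ k))"
      by (rule integral_mult_right_zero)
    ultimately show ?thesis
      by (simp only: hankel_coeff_def mult.assoc[symmetric])
  qed
  show "(\<lambda>k. hankel_coeff g k * (fact k / of_real p ^ Suc k)) sums
           (1 / (2 * of_real p) * (LINT r|Rplus. g r * of_real (exp (- (r / (4 * p))))))"
    using sums_mult[OF S, of "1 / (2 * of_real p)"] unfolding eq .
qed

section \<open>Borel representatives of radial profiles\<close>

lemma L2_Rplus_extend_zero:
  assumes "h \<in> L2 Rplus"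
  shows "(\<lambda>t. indicator {0<..} t *\<^sub>R h t) \<in> borel_measurable borel"
  using assms
  by (simp add: L2_def Rplus_def borel_measurable_restrict_space_iff cong: measurable_cong_sets)

lemma L2_cong_Rplus:
  assumes "h \<in> L2 Rplus" "h' \<in> borel_measurable borel" "\<And>t. t > 0 \<Longrightarrow> h' t = h t"
  shows "h' \<in> L2 Rplus"
proof -
  have "integrable Rplus (\<lambda>t. (norm (h' t))\<^sup>2) \<longleftrightarrow> integrable Rplus (\<lambda>t. (norm (h t))\<^sup>2)"
    using assms(3) by (intro Bochner_Integration.integrable_cong) (auto simp: space_Rplus)
  then show ?thesis
    using assms(1) borel_measurable_Rplus[OF assms(2)] by (simp add: L2_def)
qed

text \<open>\<open>is_Psi\<close> leaves the profile arbitrary off the positive half-line, where it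
  need not be measurable. Extension by 0 repairs this and affects the radial function at the origin
  only, a null set.\<close>

lemma is_Psi_borel:
  assumes "is_Psi f g"
  obtains h where "h \<in> borel_measurable borel" "h \<in> L2 Rplus" "\<forall>t>0. h t = g t"
    and "AE x in lborel. f x = h ((norm x)\<^sup>2)"
proof
  let ?h = "\<lambda>t. indicator {0<..} t *\<^sub>R g t"
  have g: "g \<in> L2 Rplus" and fg: "AE x in lborel. f x = g ((norm x)\<^sup>2)"
    using assms by (auto simp: is_Psi_def)
  show m: "?h \<in> borel_measurable borel"
    by (rule L2_Rplus_extend_zero[OF g])
  show eq: "\<forall>t>0. ?h t = g t"
    by simp
  show "?h \<in> L2 Rplus"
    by (rule L2_cong_Rplus[OF g m]) (use eq in blast)
  show "AE x in lborel. f x = ?h ((norm x)\<^sup>2)"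
    using fg AE_lborel_singleton[of 0] by eventually_elim simp
qed

lemma integral_radial_gaussian:
  fixes f :: "real^2 \<Rightarrow> complex"
  assumes f: "f \<in> L2 lborel" and h[measurable]: "h \<in> borel_measurable borel"
    and fh: "AE x in lborel. f x = h ((norm x)\<^sup>2)"
  shows "(LINT x|lborel. f x * of_real (exp (- (p * (norm x)\<^sup>2)))) =
    of_real pi * (LINT t|Rplus. h t * of_real (exp (- (p * t))))"
proof -
  have [measurable]: "f \<in> borel_measurable borel"
    using f by (simp add: L2_def)
  have "(LINT x|lborel. f x * of_real (exp (- (p * (norm x)\<^sup>2)))) =
      (LINT x::real^2|lborel. h ((norm x)\<^sup>2) * of_real (exp (- (p * (norm x)\<^sup>2))))"
    by (rule integral_cong_AE) (use fh in \<open>measurable, auto elim!: eventually_mono\<close>)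
  also have "\<dots> = of_real pi * (LINT t|Rplus. h t * of_real (exp (- (p * t))))"
    by (rule integral_norm_square) measurable
  finally show ?thesis .
qed

section \<open>Composition with the sum of squares, order and type\<close>

lemma norm_complex2_sq:
  fixes s :: "complex^2"
  shows "(norm s)\<^sup>2 = (norm (s $ 1))\<^sup>2 + (norm (s $ 2))\<^sup>2"
  by (simp add: norm_vec_def L2_set_def sum_2)

lemma norm_sum_squares_le:
  fixes s :: "complex^2"
  shows "norm ((s $ 1)\<^sup>2 + (s $ 2)\<^sup>2) \<le> (norm s)\<^sup>2"
  unfolding norm_complex2_sq by (rule norm_triangle_le) (simp add: norm_power)

lemma sum_squares_complex_vec:
  fixes x :: "real^2"
  shows "(complex_vec x $ 1)\<^sup>2 + (complex_vec x $ 2)\<^sup>2 = of_real ((norm x)\<^sup>2)"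
  by (simp add: complex_vec_def norm_vec_def L2_set_def sum_2)

text \<open>By the chain rule the differential is multiplication by \<open>deriv E\<close> after the
  differential of the quadratic form; both are complex linear, as \<open>entire_vec\<close>
  demands.\<close>

lemma entire_vec_sum_squares:
  assumes "E holomorphic_on UNIV"
  shows "entire_vec (\<lambda>s::complex^2. E ((s $ 1)\<^sup>2 + (s $ 2)\<^sup>2))"
  unfolding entire_vec_def
proof
  fix z :: "complex^2"
  let ?q = "\<lambda>s::complex^2. (s $ 1)\<^sup>2 + (s $ 2)\<^sup>2"
  let ?D = "\<lambda>v::complex^2. deriv E (?q z) * (2 * z $ 1 * v $ 1 + 2 * z $ 2 * v $ 2)"
  have nth: "((\<lambda>s::complex^2. s $ i) has_derivative (\<lambda>v::complex^2. v $ i)) (at z)" for i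
    by (rule bounded_linear_imp_has_derivative) (rule bounded_linear_vec_nth)
  have "(?q has_derivative (\<lambda>v::complex^2. 2 * z $ 1 * v $ 1 + 2 * z $ 2 * v $ 2)) (at z)"
    by (rule derivative_eq_intros nth refl | simp add: mult_ac)+
  moreover have "(E has_derivative (*) (deriv E (?q z))) (at (?q z))"
    using holomorphic_derivI[OF assms open_UNIV UNIV_I] by (simp add: has_field_derivative_def)
  ultimately have "((\<lambda>s. E (?q s)) has_derivative ?D) (at z)"
    by (rule has_derivative_compose)
  moreover have "?D (c *s v) = c * ?D v" for c v
    by (simp add: algebra_simps)
  ultimately show "\<exists>D. ((\<lambda>s. E (?q s)) has_derivative D) (at z) \<and> (\<forall>c v. D (c *s v) = c * D v)"
    by (intro exI[of _ ?D] conjI allI)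
qed

lemma order_type_leI:
  fixes E :: "'a::real_normed_vector \<Rightarrow> complex"
  assumes "\<And>z. norm (E z) \<le> C * exp (T * norm z ^ n)" "C \<ge> 0" "n > 0"
  shows "order_type_le E (real n) T"
  unfolding order_type_le_def
proof (intro allI impI exI)
  fix \<epsilon> :: real and z :: 'a assume "\<epsilon> > 0"
  \<comment> \<open>At norm 0 the two powers agree only because n > 0: \<open>0 powr 0\<close> is 0,
    whereas \<open>0 ^ 0\<close> is 1.\<close>
  have pow: "norm z powr real n = norm z ^ n"
    using \<open>n > 0\<close> by (cases "norm z = 0") (auto simp: powr_realpow)
  have "C * exp (T * norm z ^ n) \<le> C * exp ((T + \<epsilon>) * norm z ^ n)"
    using \<open>\<epsilon> > 0\<close> \<open>C \<ge> 0\<close> by (intro mult_left_mono) (auto intro!: mult_right_mono)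
  then show "norm (E z) \<le> C * exp ((T + \<epsilon>) * norm z powr real n)"
    unfolding pow using assms(1)[of z] by linarith
qed

section \<open>Identification of the transform with the entire function\<close>

theorem theorem3p8:
  fixes L T :: real
    and f F :: "real^2 \<Rightarrow> complex"
    and G :: "real \<Rightarrow> complex"
  assumes "L > 0" and "T > 0"
    and "f \<in> radial_L2"
    and "AE x in lborel. x \<noteq> 0 \<longrightarrow>
           norm (f x) \<le> L / (2 * pi) * exp (- ((norm x)\<^sup>2 / (4 * T)))
                         * ln (1 + 4 * T / (norm x)\<^sup>2)"
    and "is_fourier_transform f F"
    and "is_Psi F G"
  shows "\<exists>Ge :: complex \<Rightarrow> complex.
           Ge holomorphic_on UNIV \<and>
           (AE t in Rplus. Ge (of_real t) = G t) \<and>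
           order_type_le Ge 1 T \<and>
           (\<exists>Fe :: complex^2 \<Rightarrow> complex.
              entire_vec Fe \<and>
              (AE x in lborel. Fe (complex_vec x) = F x) \<and>
              (\<forall>s. Fe s = Ge ((s $ 1)\<^sup>2 + (s $ 2)\<^sup>2)) \<and>
              order_type_le Fe 2 T)"
proof -
  obtain g\<^sub>0 where "is_Psi f g\<^sub>0"
    using assms(3) by (auto simp: radial_L2_def)
  then obtain g where gb[measurable]: "g \<in> borel_measurable borel"
    and g2: "g \<in> L2 Rplus" and "\<forall>t>0. g t = g\<^sub>0 t"
    and fg: "AE x in lborel. f x = g ((norm x)\<^sup>2)"
    by (rule is_Psi_borel)
  obtain H where Hb[measurable]: "H \<in> borel_measurable borel"
    and H2: "H \<in> L2 Rplus" and HG: "\<forall>t>0. H t = G t"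
    and FH: "AE x in lborel. F x = H ((norm x)\<^sup>2)"
    by (rule is_Psi_borel[OF assms(6)])
  have f2: "f \<in> L2 lborel" and F2: "F \<in> L2 lborel"
    using assms(5) by (auto simp: is_fourier_transform_def)
  have "Measurable.pred borel (\<lambda>r. norm (g r) \<le> L / (2 * pi) * exp (- (r / (4 * T))) * ln (1 + 4 * T / r))"
  proof -
    have "(\<lambda>r. norm (g r)) \<in> borel_measurable borel"
      by measurable
    moreover have "(\<lambda>r. L / (2 * pi) * exp (- (r / (4 * T))) * ln (1 + 4 * T / r)) \<in> borel_measurable borel"
      by measurable
    ultimately show ?thesis
      unfolding pred_def by (rule borel_measurable_le)
  qed
  note AE_norm_square_iff[OF this]
  moreover have "AE x::real^2 in lborel. norm (g ((norm x)\<^sup>2)) \<le>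
      L / (2 * pi) * exp (- ((norm x)\<^sup>2 / (4 * T))) * ln (1 + 4 * T / (norm x)\<^sup>2)"
    using fg assms(4) AE_lborel_singleton[of 0] by eventually_elim simp
  ultimately have bound: "AE r in Rplus. norm (g r) \<le> L / (2 * pi) * exp (- (r / (4 * T))) * ln (1 + 4 * T / r)"
    by (rule iffD1)
  obtain C where int: "\<And>k. integrable Rplus (\<lambda>r. norm (g r) * r ^ k)"
    and le: "\<And>k. (LINT r|Rplus. norm (g r) * r ^ k) \<le> C * (fact k * (4 * T) ^ k)"
    by (rule moment_bound[OF g2 _ \<open>T > 0\<close> bound]) (use \<open>L > 0\<close> in auto)
  note hankel = hankel_coeff_bound_and_laplace[OF borel_measurable_Rplus[OF gb] \<open>T > 0\<close> int le]
  define E where "E z = (\<Sum>n. hankel_coeff g n * z ^ n)" for z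
  note E = power_series_of_exponential_type[of "hankel_coeff g", OF hankel(1) \<open>T > 0\<close>, folded E_def]
  \<comment> \<open>The sign of C is read off from the bound on the coefficient of index 0.\<close>
  have C: "C / 2 \<ge> 0"
    using order_trans[OF norm_ge_zero hankel(1)[of 0]] by simp
  \<comment> \<open>Passing to squared norms produces a factor \<pi> on both sides of the Gaussian
    duality, which cancels. What remains is the sum already found for the Laplace transform of
    E.\<close>
  have laplace: "(LINT t|Rplus. of_real (exp (- (p * t))) * E (of_real t)) =
      (LINT t|Rplus. of_real (exp (- (p * t))) * H t)" if "p > T" for p
  proof -
    have "p > 0" using that \<open>T > 0\<close> by simp
    have "of_real pi * (LINT t|Rplus. H t * of_real (exp (- (p * t)))) =
        1 / (2 * of_real p) * (of_real pi * (LINT r|Rplus. g r * of_real (exp (- (1 / (4 * p) * r)))))"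
      using is_fourier_transform_gaussian_duality[OF assms(5) \<open>p > 0\<close>]
        integral_radial_gaussian[OF F2 Hb FH, of p] integral_radial_gaussian[OF f2 gb fg, of "1 / (4 * p)"]
      by (simp only: times_divide_eq_left mult_1_left)
    moreover have "a = c * b" if "of_real pi * a = c * (of_real pi * b)" for a b c :: complex
      using that by (simp add: mult.left_commute[of c])
    ultimately have "(LINT t|Rplus. H t * of_real (exp (- (p * t)))) =
        1 / (2 * of_real p) * (LINT r|Rplus. g r * of_real (exp (- (1 / (4 * p) * r))))"
      by blast
    then have "(LINT t|Rplus. of_real (exp (- (p * t))) * H t) =
        1 / (2 * of_real p) * (LINT r|Rplus. g r * of_real (exp (- (r / (4 * p)))))"
      by (simp add: mult.commute)
    then show ?thesis
      using sums_unique2[OF E(4)[OF that] hankel(2)[OF that]] by simp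
  qed
  \<comment> \<open>The exponent T + 1 lies above T, so both Laplace integrals converge there. The
    factors exp(-t)^n then shift it to T + 1 + n, which stays in the range where the transforms are
    known to agree.\<close>
  define k where "k t = of_real (exp (- ((T + 1) * t))) * (E (of_real t) - H t)" for t
  have gauss2: "integrable Rplus (\<lambda>t. (exp (- (p * t)))\<^sup>2)" if "p > 0" for p
    using integrable.intros[OF has_bochner_integral_Rplus_power_exp[of "2 * p" 0]] that
    by (simp add: mult_ac flip: exp_double)
  have iH: "integrable Rplus (\<lambda>t. of_real (exp (- (p * t))) * H t)" if "p > 0" for p
    using L2_mult_integrable[OF H2 borel_measurable_Rplus gauss2[OF that]] by (simp add: mult.commute)
  have "AE t in Rplus. k t = 0"
  proof (rule laplace_transform_unique)
    have "T + 1 > T" "T + 1 > 0" using \<open>T > 0\<close> by auto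
    then show "integrable Rplus k"
      unfolding k_def right_diff_distrib by (intro Bochner_Integration.integrable_diff E(3) iH)
    fix n :: nat
    have p: "T + 1 + real n > T" "T + 1 + real n > 0" using \<open>T > 0\<close> by auto
    have "of_real (exp (- t) ^ n) * k t =
        of_real (exp (- ((T + 1 + real n) * t))) * E (of_real t) -
        of_real (exp (- ((T + 1 + real n) * t))) * H t" for t
    proof -
      have "exp (- t) ^ n * exp (- ((T + 1) * t)) = exp (- ((T + 1 + real n) * t))"
        by (simp add: algebra_simps flip: exp_of_nat_mult exp_add)
      then show ?thesis
        unfolding k_def right_diff_distrib[symmetric] mult.assoc[symmetric] of_real_mult[symmetric]
        by (simp only:)
    qed
    then show "(LINT t|Rplus. of_real (exp (- t) ^ n) * k t) = 0"
      by (simp only: Bochner_Integration.integral_diff[OF E(3)[OF p(1)] iH[OF p(2)]] laplace[OF p(1)] diff_self)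
  qed
  then have EH: "AE t in Rplus. H t = E (of_real t)"
    by eventually_elim (simp add: k_def)
  then have EG: "AE t in Rplus. E (of_real t) = G t"
    using AE_space by eventually_elim (simp add: space_Rplus HG)
  have "continuous_on UNIV E"
    using E(1) by (rule holomorphic_on_imp_continuous_on)
  then have [measurable]: "E \<in> borel_measurable borel"
    by (rule borel_measurable_continuous_onI)
  \<comment> \<open>The transfer to the plane uses the Borel representative H, as G itself may fail
    to be measurable off the half-line.\<close>
  have "Measurable.pred borel (\<lambda>t. H t = E (of_real t))"
    by measurable
  from AE_norm_square_iff[OF this] EH
  have "AE x::real^2 in lborel. H ((norm x)\<^sup>2) = E (of_real ((norm x)\<^sup>2))"
    by (rule iffD2)
  with FH have EF: "AE x in lborel. E ((complex_vec x $ 1)\<^sup>2 + (complex_vec x $ 2)\<^sup>2) = F x"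
    unfolding sum_squares_complex_vec by eventually_elim simp
  have type_E: "order_type_le E 1 T"
    using order_type_leI[of E "C / 2" T 1] E(2) C by simp
  \<comment> \<open>Since |s1^2 + s2^2| \<le> |s|^2, growth exp(T |z|) becomes exp(T |s|^2): the
    order doubles and the type is kept.\<close>
  have "norm (E ((s $ 1)\<^sup>2 + (s $ 2)\<^sup>2)) \<le> C / 2 * exp (T * norm s ^ 2)" for s :: "complex^2"
  proof -
    have "C / 2 * exp (T * norm ((s $ 1)\<^sup>2 + (s $ 2)\<^sup>2)) \<le> C / 2 * exp (T * (norm s)\<^sup>2)"
      using C \<open>T > 0\<close> norm_sum_squares_le[of s] by (intro mult_left_mono) auto
    with E(2)[of "(s $ 1)\<^sup>2 + (s $ 2)\<^sup>2"] show ?thesis by linarith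
  qed
  then have type_F: "order_type_le (\<lambda>s::complex^2. E ((s $ 1)\<^sup>2 + (s $ 2)\<^sup>2)) 2 T"
    using order_type_leI[of "\<lambda>s::complex^2. E ((s $ 1)\<^sup>2 + (s $ 2)\<^sup>2)" "C / 2" T 2] C by simp
  show ?thesis
    by (rule exI[of _ E], intro conjI E(1) EG type_E)
      (rule exI[of _ "\<lambda>s::complex^2. E ((s $ 1)\<^sup>2 + (s $ 2)\<^sup>2)"],
        intro conjI entire_vec_sum_squares E(1) EF type_F allI refl)
qed

end
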